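(* Let $\langle\mathcal S,\mathcal A,\mathcal P,\mathcal R,\gamma\rangle$ be a discounted Markov decision process with $\gamma\in(0,1)$, let $\alpha>0$, and let $\pi$ be a stationary policy. Assume: (a) for each $s\in\mathcal S$, if $a\sim\pi(\cdot\mid s)$, then $\log\pi(a\mid s)$ is well defined almost surely; (b) $\sup_{(s,a)\in\mathcal S\times\mathcal A}\mathbb E_{r\sim R(s,a),\,(s',a')\sim\mathcal P^\pi(\cdot\mid s,a)}\bigl[|r-\gamma\alpha\log\pi(a'\mid s')|\bigr]<\infty$; (c) for every $F\in\mathcal X^{\mathrm{cdf}}$ and $x\in\mathbb R$, the map $(s,a)\mapsto\mathbb E_{r\sim R(s,a),\,(s',a')\sim\mathcal P^\pi(\cdot\mid s,a)}\bigl[F(s',a')\bigl(\tfrac{x-r}{\gamma}+\alpha\log\pi(a'\mid s')\bigr)\bigr]$ is measurable. Then $\mathcal T^\pi_{\mathrm{cdf}}$ is a $\sqrt\gamma$-contraction on $(\mathcal X^{\mathrm{cdf}},d_{\mathrm{Cr}})$: for all $F_1,F_2\in\mathcal X^{\mathrm{cdf}}$, $$d_{\mathrm{Cr}}(\mathcal T^\pi_{\mathrm{cdf}}F_1,\mathcal T^\pi_{\mathrm{cdf}}F_2)\le\sqrt\gamma\,d_{\mathrm{Cr}}(F_1,F_2).$$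
   Context: MDP: $\mathcal S,\mathcal A$ are measurable spaces (states, actions), $\mathcal P(\cdot\mid s,a)$ is a transition kernel on $\mathcal S$, $\mathcal R:\mathcal S\times\mathcal A\times\mathcal S\to\mathbb R$ is a (measurable) reward function. A stationary policy $\pi$ assigns to each $s$ a probability distribution $\pi(\cdot\mid s)$ on $\mathcal A$; $\pi(a\mid s)$ denotes the value of its probability mass function / density. Sampling: $(s',a')\sim\mathcal P^\pi(\cdot\mid s,a)$ means $s'\sim\mathcal P(\cdot\mid s,a)$ and then $a'\sim\pi(\cdot\mid s')$; $r\sim R(s,a)$ denotes the one-step reward $r=\mathcal R(s,a,s')$ generated by the same next state $s'$. Cramér distance between laws on $\mathbb R$: $d_C(P_1,P_2)=\bigl(\int_{\mathbb R}(F_{P_1}(x)-F_{P_2}(x))^2dx\bigr)^{1/2}$, where $F_P$ is the CDF of $P$. $\delta_0$ is the Dirac law at $0$. $\Gamma_F$ is the set of CDFs $F_P$ of laws $P$ on $\mathbb R$ with $d_C(P,\delta_0)<\infty$. $\mathcal X^{\mathrm{cdf}}$ is the set of all CDF fields $F:(s,a)\mapsto F(s,a)\in\Gamma_F$ (with $(s,a)\mapsto F(s,a)(x)$ measurable for each $x\in\mathbb R$) such that $\sup_{(s,a)}\int_{\mathbb R}(F(s,a)(x)-\mathbf 1\{x\ge0\})^2dx<\infty$. Metric: $d_{\mathrm{Cr}}(F_1,F_2):=\sup_{(s,a)\in\mathcal S\times\mathcal A}\bigl(\int_{\mathbb R}(F_1(s,a)(x)-F_2(s,a)(x))^2dx\bigr)^{1/2}$.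 Operator: for $F\in\mathcal X^{\mathrm{cdf}}$, $(\mathcal T^\pi_{\mathrm{cdf}}F)(s,a)(x):=\mathbb E_{r\sim R(s,a),\,(s',a')\sim\mathcal P^\pi(\cdot\mid s,a)}\bigl[F(s',a')\bigl(\tfrac{x-r}{\gamma}+\alpha\log\pi(a'\mid s')\bigr)\bigr]$. *)

theory Defs
  imports "HOL-Probability.Probability"
begin

locale mdp =
  fixes S :: "'s measure" and A :: "'a measure"
    and P :: "'s \<times> 'a \<Rightarrow> 's measure"
    and R :: "'s \<Rightarrow> 'a \<Rightarrow> 's \<Rightarrow> real"
  assumes transition_kernel: "P \<in> S \<Otimes>\<^sub>M A \<rightarrow>\<^sub>M prob_algebra S"
    and reward_measurable:
      "(\<lambda>(s, a, s'). R s a s') \<in> borel_measurable (S \<Otimes>\<^sub>M A \<Otimes>\<^sub>M S)"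

text \<open>
  Here \<open>p s a\<close> is the value written $\pi(a \mid s)$: the density of \<open>\<pi> s\<close> with respect to a
  reference measure \<open>\<nu>\<close> on the action space. Taking counting measure for \<open>\<nu>\<close> makes \<open>p s\<close> the
  probability mass function of \<open>\<pi> s\<close>. The measure carried by \<open>A\<close> (and by \<open>S\<close>) is irrelevant;
  only the underlying \<open>\<sigma>\<close>-algebra is used.
\<close>

locale stationary_policy =
  fixes S :: "'s measure" and A :: "'a measure"
    and \<nu> :: "'a measure"
    and \<pi> :: "'s \<Rightarrow> 'a measure"
    and p :: "'s \<Rightarrow> 'a \<Rightarrow> real"
  assumes policy_kernel: "\<pi> \<in> S \<rightarrow>\<^sub>M prob_algebra A"
    and sets_reference: "sets \<nu> = sets A"
    and density_measurable: "(\<lambda>(s, a). p s a) \<in> borel_measurable (S \<Otimes>\<^sub>M A)"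
    and density_nonneg: "\<And>s a. s \<in> space S \<Longrightarrow> a \<in> space A \<Longrightarrow> 0 \<le> p s a"
    and policy_density: "\<And>s. s \<in> space S \<Longrightarrow> \<pi> s = density \<nu> (\<lambda>a. ennreal (p s a))"

text \<open>The law of \<open>(s', a')\<close> where \<open>s'\<close> is drawn from \<open>P (s, a)\<close> and then \<open>a'\<close> from \<open>\<pi> s'\<close>.\<close>

definition next_pair ::
  "'s measure \<Rightarrow> 'a measure \<Rightarrow> ('s \<times> 'a \<Rightarrow> 's measure) \<Rightarrow> ('s \<Rightarrow> 'a measure)
    \<Rightarrow> 's \<Rightarrow> 'a \<Rightarrow> ('s \<times> 'a) measure" where
  "next_pair S A P \<pi> s a =
     P (s, a) \<bind> (\<lambda>s'. \<pi> s' \<bind> (\<lambda>a'. return (S \<Otimes>\<^sub>M A) (s', a')))"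

text \<open>Square root on the extended half-line, so that distances may take the value \<open>\<infinity>\<close>.\<close>

definition ennsqrt :: "ennreal \<Rightarrow> ennreal" where
  "ennsqrt x = (if x = \<infinity> then \<infinity> else ennreal (sqrt (enn2real x)))"

definition sq_diff_integral :: "(real \<Rightarrow> real) \<Rightarrow> (real \<Rightarrow> real) \<Rightarrow> ennreal" where
  "sq_diff_integral f g = (\<integral>\<^sup>+ x. ennreal ((f x - g x)\<^sup>2) \<partial>lborel)"

definition cramer_dist :: "real measure \<Rightarrow> real measure \<Rightarrow> ennreal" where
  "cramer_dist P Q = ennsqrt (sq_diff_integral (cdf P) (cdf Q))"

definition Gamma_cdf :: "(real \<Rightarrow> real) set" where
  "Gamma_cdf = {cdf Q | Q. real_distribution Q \<and> cramer_dist Q (return borel 0) < \<infinity>}"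

text \<open>
  Fields are extensional functions on \<open>space S \<times> space A\<close>, so that two fields are equal iff they
  agree at every state-action pair.
\<close>

definition cdf_fields :: "'s measure \<Rightarrow> 'a measure \<Rightarrow> ('s \<times> 'a \<Rightarrow> real \<Rightarrow> real) set" where
  "cdf_fields S A = {F \<in> (space S \<times> space A) \<rightarrow>\<^sub>E Gamma_cdf.
     (\<forall>x. (\<lambda>z. F z x) \<in> borel_measurable (S \<Otimes>\<^sub>M A)) \<and>
     (SUP z\<in>space S \<times> space A. sq_diff_integral (F z) (indicat_real {0..})) < \<infinity>}"

definition cramer_sup_dist ::
  "'s measure \<Rightarrow> 'a measure \<Rightarrow> ('s \<times> 'a \<Rightarrow> real \<Rightarrow> real) \<Rightarrow> ('s \<times> 'a \<Rightarrow> real \<Rightarrow> real) \<Rightarrow> ennreal"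
  where
  "cramer_sup_dist S A F G = (SUP z\<in>space S \<times> space A. ennsqrt (sq_diff_integral (F z) (G z)))"

definition soft_cdf_operator ::
  "'s measure \<Rightarrow> 'a measure \<Rightarrow> ('s \<times> 'a \<Rightarrow> 's measure) \<Rightarrow> ('s \<Rightarrow> 'a \<Rightarrow> 's \<Rightarrow> real) \<Rightarrow> real \<Rightarrow> real
    \<Rightarrow> ('s \<Rightarrow> 'a measure) \<Rightarrow> ('s \<Rightarrow> 'a \<Rightarrow> real)
    \<Rightarrow> ('s \<times> 'a \<Rightarrow> real \<Rightarrow> real) \<Rightarrow> ('s \<times> 'a \<Rightarrow> real \<Rightarrow> real)" where
  "soft_cdf_operator S A P R \<gamma> \<alpha> \<pi> p F =
     (\<lambda>(s, a) \<in> space S \<times> space A. \<lambda>x.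
        \<integral> (s', a'). F (s', a') ((x - R s a s') / \<gamma> + \<alpha> * ln (p s' a')) \<partial>next_pair S A P \<pi> s a)"



lemma ennsqrt_mono: "x \<le> y \<Longrightarrow> ennsqrt x \<le> ennsqrt y"
  by (auto simp: ennsqrt_def top_unique less_top intro!: ennreal_leI enn2real_mono)

lemma cramer_sup_dist_finite:
  assumes F: "F \<in> cdf_fields S A" and G: "G \<in> cdf_fields S A"
  shows "cramer_sup_dist S A F G < \<infinity>"
proof -
  let ?Z = "space S \<times> space A" and ?h = "indicat_real {0..}"
  define B where "B F = (SUP z\<in>?Z. sq_diff_integral (F z) ?h)" for F :: "'a \<times> 'b \<Rightarrow> real \<Rightarrow> real"
  have fin: "2 * (B F + B G) < \<infinity>"
    using F G by (auto simp: cdf_fields_def B_def ennreal_mult_less_top)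
  have meas: "H z \<in> borel_measurable borel" if "H \<in> cdf_fields S A" "z \<in> ?Z" for H z
  proof -
    have "H z \<in> Gamma_cdf" using that by (auto simp: cdf_fields_def)
    then obtain Q where Q: "H z = cdf Q" "real_distribution Q" by (auto simp: Gamma_cdf_def)
    interpret real_distribution Q by fact
    show ?thesis
      unfolding Q by (intro borel_measurable_mono monoI cdf_nondecreasing)
  qed
  have "sq_diff_integral (F z) (G z) \<le> 2 * (B F + B G)" if z: "z \<in> ?Z" for z
  proof -
    note [measurable] = meas[OF F z] meas[OF G z]
    have pt: "(a - b)\<^sup>2 \<le> 2 * ((a - c)\<^sup>2 + (b - c)\<^sup>2)" for a b c :: real
      using zero_le_power2[of "(a - c) + (b - c)"] by (simp add: power2_eq_square algebra_simps)
    have "sq_diff_integral (F z) (G z)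
        \<le> (\<integral>\<^sup>+x. 2 * (ennreal ((F z x - ?h x)\<^sup>2) + ennreal ((G z x - ?h x)\<^sup>2)) \<partial>lborel)"
      unfolding sq_diff_integral_def
    proof (rule nn_integral_mono)
      fix x
      have "ennreal ((F z x - G z x)\<^sup>2) \<le> ennreal (2 * ((F z x - ?h x)\<^sup>2 + (G z x - ?h x)\<^sup>2))"
        by (intro ennreal_leI pt)
      then show "ennreal ((F z x - G z x)\<^sup>2)
          \<le> 2 * (ennreal ((F z x - ?h x)\<^sup>2) + ennreal ((G z x - ?h x)\<^sup>2))"
        by (simp add: ennreal_mult)
    qed
    also have "\<dots> = 2 * (sq_diff_integral (F z) ?h + sq_diff_integral (G z) ?h)"
      unfolding sq_diff_integral_def by (simp add: nn_integral_cmult nn_integral_add)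
    also have "\<dots> \<le> 2 * (B F + B G)"
      unfolding B_def using z by (intro mult_left_mono add_mono SUP_upper) auto
    finally show ?thesis .
  qed
  then have "cramer_sup_dist S A F G \<le> ennsqrt (2 * (B F + B G))"
    unfolding cramer_sup_dist_def by (intro SUP_least ennsqrt_mono)
  also have "\<dots> < \<infinity>" using fin by (auto simp: ennsqrt_def less_top)
  finally show ?thesis .
qed

end

theory Submission
  imports Defs
begin

text \<open>
  Put \<open>g (s', a') = R s a s' - \<gamma> * \<alpha> * ln (p s' a')\<close>. Then \<open>(x - r) / \<gamma> + \<alpha> * ln (p s' a')\<close> is
  \<open>(x - g (s', a')) / \<gamma>\<close>, so the operator averages the CDFs \<open>x \<mapsto> F z ((x - g z) / \<gamma>)\<close> over the law
  of the next pair \<open>z\<close>. By Jensen and Tonelli the squared \<open>L\<^sup>2\<close> distance of two such averages is at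
  most the average of the squared distances, and the substitution \<open>y = (x - g z) / \<gamma>\<close> turns each
  of these into \<open>\<gamma>\<close> times the original one. Comparing instead with \<open>1\<^bsub>x \<ge> 0\<^esub>\<close> costs the
  additional term \<open>\<integral> (1\<^bsub>x \<ge> g z\<^esub> - 1\<^bsub>x \<ge> 0\<^esub>)\<^sup>2 dx = \<bar>g z\<bar>\<close>, whose average is controlled by the moment
  hypothesis.
\<close>

section \<open>Distribution functions of laws on the real line\<close>

definition distribution_functions :: "(real \<Rightarrow> real) set" where
  "distribution_functions = cdf ` Collect real_distribution"

lemma distribution_functionsD:
  assumes "F \<in> distribution_functions"
  shows "mono F" "continuous (at_right a) F" "(F \<longlongrightarrow> 0) at_bot" "(F \<longlongrightarrow> 1) at_top"
    "0 \<le> F x" "F x \<le> 1" "F \<in> borel_measurable borel"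
proof -
  obtain Q where Q: "real_distribution Q" "F = cdf Q"
    using assms by (auto simp: distribution_functions_def)
  interpret real_distribution Q by (rule Q)
  show "mono F"
    unfolding Q by (intro monoI cdf_nondecreasing)
  then show "F \<in> borel_measurable borel"
    by (rule borel_measurable_mono)
  show "continuous (at_right a) F" "(F \<longlongrightarrow> 0) at_bot" "(F \<longlongrightarrow> 1) at_top" "0 \<le> F x" "F x \<le> 1"
    unfolding Q by (rule cdf_is_right_cont cdf_lim_at_bot cdf_lim_at_top_prob cdf_nonneg cdf_bounded_prob)+
qed

text \<open>The witnessing law is the Lebesgue-Stieltjes measure \<open>interval_measure F\<close>.
  This converse of \<open>distribution_functionsD\<close> allows averages of CDFs to be recognised
  by their analytic properties alone.\<close>

lemma distribution_functionsI:
  assumes "mono F" "\<And>a. continuous (at_right a) F" "(F \<longlongrightarrow> 0) at_bot" "(F \<longlongrightarrow> 1) at_top"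
  shows "F \<in> distribution_functions"
proof -
  have "cdf (interval_measure F) = F"
    using assms by (intro cdf_interval_measure) (auto dest: monoD)
  moreover have "real_distribution (interval_measure F)"
    using assms by (intro real_distribution_interval_measure) (auto dest: monoD)
  ultimately show ?thesis
    unfolding distribution_functions_def by (metis image_eqI mem_Collect_eq)
qed

text \<open>If \<open>Y\<close> has CDF \<open>F\<close>, then \<open>t + c * Y\<close> has the CDF
  on the left; positivity of \<open>c\<close> keeps the direction of the inequality defining the
  event.\<close>

lemma distribution_functions_affine:
  assumes "F \<in> distribution_functions" and c: "0 < (c::real)"
  shows "(\<lambda>x. F ((x - t) / c)) \<in> distribution_functions"
proof -
  obtain Q where Q: "real_distribution Q" "F = cdf Q"
    using assms by (auto simp: distribution_functions_def)
  interpret real_distribution Q by (rule Q)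
  let ?Q = "distr Q borel (\<lambda>y. t + c * y)"
  have "real_distribution ?Q"
    by (rule real_distribution_distr) simp
  moreover have "cdf ?Q x = F ((x - t) / c)" for x
  proof -
    have "(\<lambda>y. t + c * y) -` {..x} = {..(x - t) / c}"
      using c by (auto simp: field_simps)
    then show ?thesis
      unfolding Q cdf_def by (subst measure_distr) auto
  qed
  ultimately show ?thesis
    unfolding distribution_functions_def by (intro image_eqI[where x = ?Q]) auto
qed

section \<open>Squared distances between CDFs\<close>

lemma cdf_return_zero: "cdf (return borel 0) = indicat_real {0..}"
  by (auto simp: cdf_def fun_eq_iff measure_return indicator_def)

text \<open>Moves estimates from distances to squared integrals, which are the quantities that
  average and rescale well.\<close>

lemma ennsqrt_le_ennreal_iff:
  assumes "0 \<le> c"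
  shows "ennsqrt x \<le> ennreal c \<longleftrightarrow> x \<le> ennreal (c\<^sup>2)"
proof (cases x)
  case (real r)
  then show ?thesis
    using assms by (simp add: ennsqrt_def real_sqrt_le_iff')
qed (simp add: ennsqrt_def top_unique)

text \<open>Splits membership into a qualitative part, which averaging preserves, and a finiteness
  part, which needs an estimate. The root is finite exactly when its argument is.\<close>

lemma Gamma_cdf_iff:
  "F \<in> Gamma_cdf \<longleftrightarrow>
    F \<in> distribution_functions \<and> sq_diff_integral F (indicat_real {0..}) < \<infinity>"
  by (auto simp: Gamma_cdf_def distribution_functions_def cramer_dist_def cdf_return_zero
      ennsqrt_def less_top)

text \<open>The Jacobian of \<open>x = t + c * y\<close> is \<open>c\<close>. With \<open>c\<close>
  equal to the discount factor, this is the source of the contraction; the shift \<open>t\<close>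
  leaves no trace.\<close>

lemma sq_diff_integral_affine:
  assumes [measurable]: "f \<in> borel_measurable borel" "g \<in> borel_measurable borel" and c: "0 < c"
  shows "sq_diff_integral (\<lambda>x. f ((x - t) / c)) (\<lambda>x. g ((x - t) / c))
    = ennreal c * sq_diff_integral f g"
  unfolding sq_diff_integral_def
  by (subst nn_integral_real_affine[where c = c and t = t]) (use c in auto)

text \<open>Pointwise, the right side minus the left is the square of
  \<open>(a - b) - (b - c)\<close>. The factor 2 is harmless, since the lemma serves only to show
  finiteness.\<close>

lemma sq_diff_integral_triangle:
  assumes [measurable]: "f \<in> borel_measurable borel" "g \<in> borel_measurable borel"
    "h \<in> borel_measurable borel"
  shows "sq_diff_integral f h \<le> 2 * sq_diff_integral f g + 2 * sq_diff_integral g h"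
proof -
  have pt: "(a - c)\<^sup>2 \<le> 2 * (a - b)\<^sup>2 + 2 * (b - c)\<^sup>2" for a b c :: real
    using zero_le_power2[of "(a - b) - (b - c)"] by (simp add: power2_eq_square algebra_simps)
  have "sq_diff_integral f h
      \<le> (\<integral>\<^sup>+x. 2 * ennreal ((f x - g x)\<^sup>2) + 2 * ennreal ((g x - h x)\<^sup>2) \<partial>lborel)"
    unfolding sq_diff_integral_def
  proof (rule nn_integral_mono)
    fix x
    show "ennreal ((f x - h x)\<^sup>2) \<le> 2 * ennreal ((f x - g x)\<^sup>2) + 2 * ennreal ((g x - h x)\<^sup>2)"
      using ennreal_leI[OF pt[of "f x" "h x" "g x"]] by (simp add: ennreal_mult)
  qed
  also have "\<dots> = 2 * sq_diff_integral f g + 2 * sq_diff_integral g h"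
    unfolding sq_diff_integral_def by (simp add: nn_integral_cmult nn_integral_add)
  finally show ?thesis .
qed

lemma sq_diff_integral_step:
  "sq_diff_integral (\<lambda>x. indicat_real {0..} (x - t)) (indicat_real {0..}) = ennreal \<bar>t\<bar>"
proof -
  \<comment> \<open>The two steps differ, by exactly 1, on the half-open interval between 0 and
    \<open>t\<close>, whichever sign \<open>t\<close> has.\<close>
  have "sq_diff_integral (\<lambda>x. indicat_real {0..} (x - t)) (indicat_real {0..})
      = (\<integral>\<^sup>+x. indicator {min 0 t..<max 0 t} x \<partial>lborel)"
    unfolding sq_diff_integral_def
    by (intro nn_integral_cong) (auto simp: indicator_def)
  also have "\<dots> = ennreal \<bar>t\<bar>"
    by (auto simp: min_def max_def)
  finally show ?thesis .
qed

section \<open>Averages over a probability space\<close>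

lemma (in prob_space) sq_diff_integral_expectation_le:
  assumes meas [measurable]: "case_prod K \<in> borel_measurable (M \<Otimes>\<^sub>M borel)"
      "case_prod L \<in> borel_measurable (M \<Otimes>\<^sub>M borel)"
    and bounds: "\<And>z x. z \<in> space M \<Longrightarrow> 0 \<le> K z x" "\<And>z x. z \<in> space M \<Longrightarrow> K z x \<le> 1"
      "\<And>z x. z \<in> space M \<Longrightarrow> 0 \<le> L z x" "\<And>z x. z \<in> space M \<Longrightarrow> L z x \<le> 1"
  shows "sq_diff_integral (\<lambda>x. expectation (\<lambda>z. K z x)) (\<lambda>x. expectation (\<lambda>z. L z x))
    \<le> (\<integral>\<^sup>+z. sq_diff_integral (K z) (L z) \<partial>M)"
proof -
  interpret pair_sigma_finite M lborel ..
  have [measurable]: "(\<lambda>z. K z x) \<in> borel_measurable M" "(\<lambda>z. L z x) \<in> borel_measurable M" for x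
    by measurable
  have "ennreal ((expectation (\<lambda>z. K z x) - expectation (\<lambda>z. L z x))\<^sup>2)
      \<le> (\<integral>\<^sup>+z. ennreal ((K z x - L z x)\<^sup>2) \<partial>M)" for x
  proof -
    let ?D = "\<lambda>z. K z x - L z x"
    have D: "\<bar>?D z\<bar> \<le> 1" if "z \<in> space M" for z
      using bounds[OF that, of x] by linarith
    have int: "integrable M (\<lambda>z. K z x)" "integrable M (\<lambda>z. L z x)"
      using bounds by (auto intro!: integrable_const_bound[where B = 1])
    have int2: "integrable M (\<lambda>z. (?D z)\<^sup>2)"
      using D by (auto intro!: integrable_const_bound[where B = 1] simp: abs_square_le_1)
    \<comment> \<open>Jensen's inequality for the square is nonnegativity of the variance of
      \<open>?D\<close>.\<close>
    have "(expectation ?D)\<^sup>2 \<le> expectation (\<lambda>z. (?D z)\<^sup>2)"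
      using variance_positive[of ?D]
        variance_eq[of ?D, OF Bochner_Integration.integrable_diff[OF int] int2]
      by linarith
    then show ?thesis
      using int int2 by (simp add: nn_integral_eq_integral ennreal_leI)
  qed
  then have "sq_diff_integral (\<lambda>x. expectation (\<lambda>z. K z x)) (\<lambda>x. expectation (\<lambda>z. L z x))
      \<le> (\<integral>\<^sup>+x. \<integral>\<^sup>+z. ennreal ((K z x - L z x)\<^sup>2) \<partial>M \<partial>lborel)"
    unfolding sq_diff_integral_def by (intro nn_integral_mono)
  also have "\<dots> = (\<integral>\<^sup>+z. sq_diff_integral (K z) (L z) \<partial>M)"
    unfolding sq_diff_integral_def by (rule Fubini') simp
  finally show ?thesis .
qed

lemma (in prob_space) expectation_distribution_functions:
  assumes meas [measurable]: "\<And>x. (\<lambda>z. K z x) \<in> borel_measurable M"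
    and K: "\<And>z. z \<in> space M \<Longrightarrow> K z \<in> distribution_functions"
  shows "(\<lambda>x. expectation (\<lambda>z. K z x)) \<in> distribution_functions"
proof (rule distribution_functionsI)
  let ?m = "\<lambda>x. expectation (\<lambda>z. K z x)"
  note bounds = distribution_functionsD(5,6)[OF K]
  have int: "integrable M (\<lambda>z. K z x)" for x
    using bounds by (auto intro!: integrable_const_bound[where B = 1])
  \<comment> \<open>Dominated convergence with constant bound 1, stated for an arbitrary filter
    \<open>L\<close> so that it covers both limits at infinity and right continuity. It works along
    sequences, hence the reduction of each limit to sequences below.\<close>
  have lim: "(\<lambda>i. ?m (X i)) \<longlonglongrightarrow> expectation k"
    if X: "filterlim X L sequentially" and [measurable]: "k \<in> borel_measurable M"
      and k: "\<And>z. z \<in> space M \<Longrightarrow> (K z \<longlongrightarrow> k z) L" for X L k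
    using bounds
    by (intro integral_dominated_convergence[where w = "\<lambda>_. 1"])
      (auto intro: filterlim_compose[OF k X])
  show "mono ?m"
    using int by (intro monoI integral_mono) (auto dest: monoD[OF distribution_functionsD(1)[OF K]])
  show "(?m \<longlongrightarrow> 0) at_bot"
    using lim[of _ at_bot "\<lambda>_. 0"] K
    by (intro tendsto_at_botI_sequentially) (auto dest: distribution_functionsD)
  show "(?m \<longlongrightarrow> 1) at_top"
    using lim[of _ at_top "\<lambda>_. 1"] K
    by (intro tendsto_at_topI_sequentially) (auto dest: distribution_functionsD simp: prob_space)
  show "continuous (at_right a) ?m" for a
    unfolding continuous_within tendsto_at_iff_sequentially comp_def
  proof (intro allI impI)
    fix X assume X: "\<forall>i. X i \<in> {a<..} - {a}" "X \<longlonglongrightarrow> a"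
    then have "filterlim X (at_right a) sequentially"
      by (simp add: filterlim_at less_imp_neq[symmetric])
    then show "(\<lambda>i. ?m (X i)) \<longlonglongrightarrow> ?m a"
      using distribution_functionsD(2)[OF K] by (intro lim) (auto simp: continuous_within)
  qed
qed

text \<open>Right continuity makes \<open>F\<close> the limit of its values at grid points just to the right.\<close>

lemma borel_measurable_distribution_functions_pair:
  assumes meas [measurable]: "\<And>x. (\<lambda>z. F z x) \<in> borel_measurable M"
    and F: "\<And>z. z \<in> space M \<Longrightarrow> F z \<in> distribution_functions"
  shows "case_prod F \<in> borel_measurable (M \<Otimes>\<^sub>M borel)"
proof (rule borel_measurable_LIMSEQ_real)
  \<comment> \<open>\<open>X n x\<close> is the first point of the grid of mesh
    \<open>1 / Suc n\<close> strictly to the right of \<open>x\<close>. The \<open>+ 1\<close> keeps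
    it strict even when \<open>x\<close> is itself a grid point, so that \<open>X n x\<close>
    approaches \<open>x\<close> within \<open>at_right x\<close>.\<close>
  define q where "q n i = (real_of_int i + 1) / real (Suc n)" for n i
  define X where "X n x = q n \<lfloor>real (Suc n) * x\<rfloor>" for n x
  \<comment> \<open>The grid is countable, so measurability of \<open>F\<close> in \<open>z\<close>
    at each fixed grid point suffices.\<close>
  show "(\<lambda>w. F (fst w) (X n (snd w))) \<in> borel_measurable (M \<Otimes>\<^sub>M borel)" for n
    unfolding X_def
    by (rule measurable_compose_countable[where g = "\<lambda>w. \<lfloor>real (Suc n) * snd w\<rfloor>"]) measurable
  fix w assume "w \<in> space (M \<Otimes>\<^sub>M (borel :: real measure))"
  then obtain z x where w: "w = (z, x)" "z \<in> space M"
    by (auto simp: space_pair_measure)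
  have lower: "x < X n x" for n
    unfolding X_def q_def by (simp add: pos_less_divide_eq mult.commute del: of_nat_Suc)
  have upper: "X n x \<le> x + 1 / real (Suc n)" for n
  proof -
    have "real_of_int \<lfloor>real (Suc n) * x\<rfloor> + 1 \<le> real (Suc n) * x + 1"
      by linarith
    then show ?thesis
      unfolding X_def q_def by (simp add: field_simps del: of_nat_Suc)
  qed
  have "(\<lambda>n. X n x) \<longlonglongrightarrow> x"
  proof (rule tendsto_sandwich[OF _ _ tendsto_const])
    show "(\<lambda>n. x + 1 / real (Suc n)) \<longlonglongrightarrow> x"
      using tendsto_add[OF tendsto_const LIMSEQ_inverse_real_of_nat, of x]
      by (simp add: inverse_eq_divide)
  qed (use less_imp_le[OF lower] upper in simp_all)
  with lower have "filterlim (\<lambda>n. X n x) (at_right x) sequentially"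
    by (simp add: filterlim_at less_imp_neq[symmetric])
  then have "(\<lambda>n. F z (X n x)) \<longlonglongrightarrow> F z x"
    using distribution_functionsD(2)[OF F[OF w(2)], of x]
    by (auto simp: continuous_within intro: filterlim_compose)
  then show "(\<lambda>n. F (fst w) (X n (snd w))) \<longlonglongrightarrow> case_prod F w"
    by (simp add: w)
qed

section \<open>The law of the next pair, CDF fields and their mixtures\<close>

lemma next_pair_in_prob_algebra:
  assumes [measurable]: "P \<in> S \<Otimes>\<^sub>M A \<rightarrow>\<^sub>M prob_algebra S" "\<pi> \<in> S \<rightarrow>\<^sub>M prob_algebra A"
    and "s \<in> space S" "a \<in> space A"
  shows "next_pair S A P \<pi> s a \<in> space (prob_algebra (S \<Otimes>\<^sub>M A))"
proof -
  have "(\<lambda>w. next_pair S A P \<pi> (fst w) (snd w)) \<in> S \<Otimes>\<^sub>M A \<rightarrow>\<^sub>M prob_algebra (S \<Otimes>\<^sub>M A)"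
    unfolding next_pair_def by measurable
  from measurable_space[OF this, of "(s, a)"] assms show ?thesis
    by (simp add: space_pair_measure)
qed

lemma cdf_fieldsD:
  assumes "F \<in> cdf_fields S A"
  shows "\<And>z. z \<in> space (S \<Otimes>\<^sub>M A) \<Longrightarrow> F z \<in> distribution_functions"
    "\<And>x. (\<lambda>z. F z x) \<in> borel_measurable (S \<Otimes>\<^sub>M A)"
    "(SUP z\<in>space (S \<Otimes>\<^sub>M A). sq_diff_integral (F z) (indicat_real {0..})) < \<infinity>"
  using assms by (auto simp: cdf_fields_def Gamma_cdf_iff space_pair_measure PiE_iff)

text \<open>
  One step of the operator, seen from a fixed state-action pair: \<open>M\<close> is the law of the next pair
  and \<open>g\<close> the soft reward.
\<close>

locale cdf_mixture = prob_space M for M :: "'z measure" +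
  fixes g :: "'z \<Rightarrow> real" and c :: real
  assumes g_measurable [measurable]: "g \<in> borel_measurable M"
    and c_pos: "0 < c"
begin

text \<open>For a family of CDFs, this is the CDF of \<open>g z + c * Y\<close>, with
  \<open>z\<close> drawn from \<open>M\<close> and then \<open>Y\<close> from the law with CDF
  \<open>F z\<close>.\<close>

definition mixture :: "('z \<Rightarrow> real \<Rightarrow> real) \<Rightarrow> real \<Rightarrow> real" where
  "mixture F x = expectation (\<lambda>z. F z ((x - g z) / c))"

context
  fixes F :: "'z \<Rightarrow> real \<Rightarrow> real"
  assumes F: "\<And>z. z \<in> space M \<Longrightarrow> F z \<in> distribution_functions"
    and F_measurable: "\<And>x. (\<lambda>z. F z x) \<in> borel_measurable M"
begin

text \<open>Exchanging the integrals over \<open>z\<close> and \<open>x\<close> needs joint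
  measurability, while a field is measurable only for each fixed \<open>x\<close>; right continuity
  closes the gap.\<close>

lemma mixture_integrand_measurable:
  "(\<lambda>(z, x). F z ((x - g z) / c)) \<in> borel_measurable (M \<Otimes>\<^sub>M borel)"
proof -
  note [measurable] = borel_measurable_distribution_functions_pair[OF F_measurable F]
  have "(\<lambda>w. case_prod F (fst w, (snd w - g (fst w)) / c)) \<in> borel_measurable (M \<Otimes>\<^sub>M borel)"
    by measurable
  then show ?thesis
    by (simp add: case_prod_beta)
qed

lemma mixture_distribution_functions: "mixture F \<in> distribution_functions"
  unfolding mixture_def
proof (rule expectation_distribution_functions)
  note [measurable] = mixture_integrand_measurable
  show "(\<lambda>z. F z ((x - g z) / c)) \<in> borel_measurable M" for x
    by measurable
qed (intro distribution_functions_affine F c_pos)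

text \<open>The step at \<open>g z\<close> is inserted between the shifted CDF and the step at 0:
  the first distance rescales by \<open>c\<close>, the second is the length of the shift.\<close>

lemma sq_diff_integral_mixture_step_le:
  assumes B: "\<And>z. z \<in> space M \<Longrightarrow> sq_diff_integral (F z) (indicat_real {0..}) \<le> B"
  shows "sq_diff_integral (mixture F) (indicat_real {0..})
    \<le> 2 * (ennreal c * B) + 2 * (\<integral>\<^sup>+z. ennreal \<bar>g z\<bar> \<partial>M)"
proof -
  let ?h = "indicat_real {0..}"
  have pt: "sq_diff_integral (\<lambda>x. F z ((x - g z) / c)) ?h
      \<le> 2 * (ennreal c * B) + 2 * ennreal \<bar>g z\<bar>" if z: "z \<in> space M" for z
  proof -
    note [measurable] = distribution_functionsD(7)[OF F[OF z]]
    have h: "(\<lambda>x. ?h ((x - g z) / c)) = (\<lambda>x. ?h (x - g z))"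
      using c_pos by (auto simp: indicator_def zero_le_divide_iff)
    have "sq_diff_integral (\<lambda>x. F z ((x - g z) / c)) ?h
        \<le> 2 * sq_diff_integral (\<lambda>x. F z ((x - g z) / c)) (\<lambda>x. ?h ((x - g z) / c))
          + 2 * sq_diff_integral (\<lambda>x. ?h ((x - g z) / c)) ?h"
      by (rule sq_diff_integral_triangle) measurable
    also have "\<dots> = 2 * (ennreal c * sq_diff_integral (F z) ?h) + 2 * ennreal \<bar>g z\<bar>"
      using c_pos by (subst sq_diff_integral_affine) (simp_all add: h sq_diff_integral_step)
    finally show ?thesis
      using B[OF z] by (meson add_right_mono mult_left_mono order_trans zero_le)
  qed
  \<comment> \<open>The fixed step is written as the expectation of a constant family, so that both
    arguments are averages.\<close>
  have "sq_diff_integral (mixture F) ?h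
      = sq_diff_integral (\<lambda>x. expectation (\<lambda>z. F z ((x - g z) / c))) (\<lambda>x. expectation (\<lambda>z. ?h x))"
    by (simp add: mixture_def[abs_def] prob_space)
  also have "\<dots> \<le> (\<integral>\<^sup>+z. sq_diff_integral (\<lambda>x. F z ((x - g z) / c)) ?h \<partial>M)"
    by (rule sq_diff_integral_expectation_le)
      (auto intro: mixture_integrand_measurable distribution_functionsD(5,6)[OF F])
  also have "\<dots> \<le> (\<integral>\<^sup>+z. 2 * (ennreal c * B) + 2 * ennreal \<bar>g z\<bar> \<partial>M)"
    by (intro nn_integral_mono pt)
  also have "\<dots> = 2 * (ennreal c * B) + 2 * (\<integral>\<^sup>+z. ennreal \<bar>g z\<bar> \<partial>M)"
    by (simp add: nn_integral_add nn_integral_cmult emeasure_space_1)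
  finally show ?thesis .
qed

end

lemma sq_diff_integral_mixture_le:
  assumes F: "\<And>z. z \<in> space M \<Longrightarrow> F z \<in> distribution_functions"
      "\<And>x. (\<lambda>z. F z x) \<in> borel_measurable M"
    and G: "\<And>z. z \<in> space M \<Longrightarrow> G z \<in> distribution_functions"
      "\<And>x. (\<lambda>z. G z x) \<in> borel_measurable M"
    and B: "\<And>z. z \<in> space M \<Longrightarrow> sq_diff_integral (F z) (G z) \<le> B"
  shows "sq_diff_integral (mixture F) (mixture G) \<le> ennreal c * B"
proof -
  have "sq_diff_integral (mixture F) (mixture G)
      \<le> (\<integral>\<^sup>+z. sq_diff_integral (\<lambda>x. F z ((x - g z) / c)) (\<lambda>x. G z ((x - g z) / c)) \<partial>M)"
    unfolding mixture_def[abs_def]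
    by (intro sq_diff_integral_expectation_le mixture_integrand_measurable F G
        distribution_functionsD(5,6)[OF F(1)] distribution_functionsD(5,6)[OF G(1)])
  also have "\<dots> \<le> (\<integral>\<^sup>+z. ennreal c * B \<partial>M)"
  proof (rule nn_integral_mono)
    fix z assume z: "z \<in> space M"
    then show "sq_diff_integral (\<lambda>x. F z ((x - g z) / c)) (\<lambda>x. G z ((x - g z) / c))
        \<le> ennreal c * B"
      using distribution_functionsD(7)[OF F(1)] distribution_functionsD(7)[OF G(1)] c_pos
      by (auto simp: sq_diff_integral_affine intro!: mult_left_mono B)
  qed
  also have "\<dots> = ennreal c * B"
    by (simp add: emeasure_space_1)
  finally show ?thesis .
qed

end

section \<open>From a single state-action pair to the supremum\<close>

theorem theorem8:
  fixes S :: "'s measure" and A :: "'a measure"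
    and P :: "'s \<times> 'a \<Rightarrow> 's measure" and R :: "'s \<Rightarrow> 'a \<Rightarrow> 's \<Rightarrow> real"
    and \<nu> :: "'a measure" and \<pi> :: "'s \<Rightarrow> 'a measure" and p :: "'s \<Rightarrow> 'a \<Rightarrow> real"
    and \<gamma> \<alpha> :: real
  assumes mdp: "mdp S A P R"
    and policy: "stationary_policy S A \<nu> \<pi> p"
    and gamma: "0 < \<gamma>" "\<gamma> < 1"
    and alpha: "0 < \<alpha>"
    and log_well_defined: "\<And>s. s \<in> space S \<Longrightarrow> AE a in \<pi> s. 0 < p s a"
    and bounded_moment:
      "(SUP (s, a)\<in>space S \<times> space A.
          \<integral>\<^sup>+ (s', a'). ennreal \<bar>R s a s' - \<gamma> * \<alpha> * ln (p s' a')\<bar> \<partial>next_pair S A P \<pi> s a) < \<infinity>"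
    and operator_measurable:
      "\<And>F x. F \<in> cdf_fields S A \<Longrightarrow>
         (\<lambda>(s, a). \<integral> (s', a'). F (s', a') ((x - R s a s') / \<gamma> + \<alpha> * ln (p s' a'))
            \<partial>next_pair S A P \<pi> s a) \<in> borel_measurable (S \<Otimes>\<^sub>M A)"
  shows "(\<forall>F\<in>cdf_fields S A. soft_cdf_operator S A P R \<gamma> \<alpha> \<pi> p F \<in> cdf_fields S A) \<and>
    (\<forall>F1\<in>cdf_fields S A. \<forall>F2\<in>cdf_fields S A.
       cramer_sup_dist S A (soft_cdf_operator S A P R \<gamma> \<alpha> \<pi> p F1)
                           (soft_cdf_operator S A P R \<gamma> \<alpha> \<pi> p F2)
       \<le> ennreal (sqrt \<gamma>) * cramer_sup_dist S A F1 F2)"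
proof -
  interpret mdp S A P R by (rule mdp)
  interpret stationary_policy S A \<nu> \<pi> p by (rule policy)
  define N where "N = S \<Otimes>\<^sub>M A"
  have space_N: "space N = space S \<times> space A"
    by (simp add: N_def space_pair_measure)
  define M where "M z = next_pair S A P \<pi> (fst z) (snd z)" for z
  define g where "g z w = R (fst z) (snd z) (fst w) - \<gamma> * \<alpha> * ln (p (fst w) (snd w))" for z w
  define T where "T = soft_cdf_operator S A P R \<gamma> \<alpha> \<pi> p"

  have M: "sets (M z) = sets N" "space (M z) = space N" "cdf_mixture (M z) (g z) \<gamma>"
    if z: "z \<in> space N" for z
  proof -
    have "M z \<in> space (prob_algebra N)"
      using next_pair_in_prob_algebra[OF transition_kernel policy_kernel, of "fst z" "snd z"] z
      by (auto simp: M_def N_def space_pair_measure)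
    then have sets: "sets (M z) = sets N" and prob: "prob_space (M z)"
      by (auto simp: space_prob_algebra)
    show "sets (M z) = sets N" "space (M z) = space N"
      using sets sets_eq_imp_space_eq by auto
    have [measurable]: "(\<lambda>w. R (fst z) (snd z) (fst w)) \<in> borel_measurable N"
    proof -
      have "(\<lambda>w. (fst z, snd z, fst w)) \<in> N \<rightarrow>\<^sub>M S \<Otimes>\<^sub>M A \<Otimes>\<^sub>M S"
        using z unfolding N_def by (auto simp: space_pair_measure)
      from measurable_compose[OF this reward_measurable] show ?thesis
        by simp
    qed
    have [measurable]: "(\<lambda>w. p (fst w) (snd w)) \<in> borel_measurable N"
      using density_measurable by (simp add: N_def case_prod_beta)
    have "g z \<in> borel_measurable N"
      unfolding g_def by measurable
    then have "g z \<in> borel_measurable (M z)"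
      by (simp cong: measurable_cong_sets add: sets)
    then show "cdf_mixture (M z) (g z) \<gamma>"
      using prob gamma by (simp add: cdf_mixture_def cdf_mixture_axioms_def)
  qed
  note [measurable_cong] = M(1)

  have T_eq: "T F z = cdf_mixture.mixture (M z) (g z) \<gamma> F" if z: "z \<in> space N" for F z
  proof -
    have arg: "(x - r) / \<gamma> + \<alpha> * l = (x - (r - \<gamma> * \<alpha> * l)) / \<gamma>" for x r l
      using gamma by (simp add: field_simps)
    show ?thesis
      using z unfolding cdf_mixture.mixture_def[OF M(3)[OF z]]
      by (auto simp: T_def soft_cdf_operator_def space_N M_def g_def arg case_prod_unfold fun_eq_iff)
  qed

  \<comment> \<open>The point \<open>w\<close> is a premise of the measurability claim as well;
    later uses supply one from \<open>not_empty\<close>, as a probability space has points.\<close>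
  have field: "F w \<in> distribution_functions" "(\<lambda>w. F w x) \<in> borel_measurable (M z)"
    if "F \<in> cdf_fields S A" "z \<in> space N" "w \<in> space (M z)" for F z w x
    using cdf_fieldsD(1,2)[OF that(1)] M(2)[OF that(2)] that
    by (simp_all add: measurable_cong_sets[OF M(1)[OF that(2)] refl] flip: N_def)

  have T_field: "T F \<in> cdf_fields S A" if F: "F \<in> cdf_fields S A" for F
  proof -
    let ?h = "indicat_real {0..}"
    define B where "B = (SUP z\<in>space N. sq_diff_integral (F z) ?h)"
    define C where "C = (SUP z\<in>space N. \<integral>\<^sup>+w. ennreal \<bar>g z w\<bar> \<partial>M z)"
    have B: "B < \<infinity>"
      using cdf_fieldsD(3)[OF F] by (simp add: B_def N_def)
    have C: "C < \<infinity>"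
      using bounded_moment by (simp add: C_def space_N M_def g_def case_prod_unfold)
    have fin: "2 * (ennreal \<gamma> * B) + 2 * C < \<infinity>"
      using B C by (simp add: ennreal_mult_less_top)
    have bound: "sq_diff_integral (T F z) ?h \<le> 2 * (ennreal \<gamma> * B) + 2 * C"
      if z: "z \<in> space N" for z
    proof -
      interpret cdf_mixture "M z" "g z" \<gamma> by (rule M(3)[OF z])
      have "sq_diff_integral (mixture F) ?h
          \<le> 2 * (ennreal \<gamma> * B) + 2 * (\<integral>\<^sup>+w. ennreal \<bar>g z w\<bar> \<partial>M z)"
        using field[OF F z] not_empty
        by (intro sq_diff_integral_mixture_step_le) (auto simp: B_def M(2)[OF z] intro: SUP_upper)
      also have "\<dots> \<le> 2 * (ennreal \<gamma> * B) + 2 * C"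
        unfolding C_def using z by (intro add_left_mono mult_left_mono SUP_upper) auto
      finally show ?thesis
        by (simp add: T_eq z)
    qed
    have Gamma: "T F z \<in> Gamma_cdf" if z: "z \<in> space N" for z
    proof -
      interpret cdf_mixture "M z" "g z" \<gamma> by (rule M(3)[OF z])
      have "T F z \<in> distribution_functions"
        unfolding T_eq[OF z]
        using field[OF F z] not_empty by (intro mixture_distribution_functions) auto
      then show ?thesis
        using le_less_trans[OF bound[OF z] fin] by (simp add: Gamma_cdf_iff)
    qed
    \<comment> \<open>On \<open>space N\<close> the restricted operator agrees with the unrestricted
      integral whose measurability is assumed.\<close>
    have "(\<lambda>z. T F z x) \<in> borel_measurable N" for x
      using operator_measurable[OF F, of x] unfolding N_def
      by (rule measurable_cong[THEN iffD1, rotated])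
        (auto simp: T_def soft_cdf_operator_def space_pair_measure)
    moreover have "(SUP z\<in>space N. sq_diff_integral (T F z) ?h) < \<infinity>"
      using SUP_least[OF bound] fin by (rule le_less_trans)
    moreover have "T F \<in> space N \<rightarrow>\<^sub>E Gamma_cdf"
      using Gamma by (auto simp: PiE_iff T_def soft_cdf_operator_def space_N)
    ultimately show ?thesis
      by (simp add: cdf_fields_def flip: space_N N_def)
  qed

  have "cramer_sup_dist S A (T F) (T G) \<le> ennreal (sqrt \<gamma>) * cramer_sup_dist S A F G"
    if F: "F \<in> cdf_fields S A" and G: "G \<in> cdf_fields S A" for F G
  proof -
    \<comment> \<open>The distance is finite between fields, so the remaining estimates concern a
      real \<open>d\<close>, and the square root can be undone by squaring.\<close>
    obtain d where d: "0 \<le> d" "cramer_sup_dist S A F G = ennreal d"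
      using cramer_sup_dist_finite[OF F G] by (cases "cramer_sup_dist S A F G") auto
    have FG: "sq_diff_integral (F w) (G w) \<le> ennreal (d\<^sup>2)" if "w \<in> space N" for w
    proof -
      have "ennsqrt (sq_diff_integral (F w) (G w)) \<le> cramer_sup_dist S A F G"
        unfolding cramer_sup_dist_def using that by (intro SUP_upper) (simp add: space_N)
      with d show ?thesis
        by (simp add: ennsqrt_le_ennreal_iff)
    qed
    have "ennsqrt (sq_diff_integral (T F z) (T G z)) \<le> ennreal (sqrt \<gamma> * d)"
      if z: "z \<in> space N" for z
    proof -
      interpret cdf_mixture "M z" "g z" \<gamma> by (rule M(3)[OF z])
      \<comment> \<open>The right side is the square of \<open>sqrt \<gamma> * d\<close>: scaling
        the squared integral by \<gamma> gives the modulus \<open>sqrt \<gamma>\<close> for the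
        metric.\<close>
      have "sq_diff_integral (T F z) (T G z) \<le> ennreal \<gamma> * ennreal (d\<^sup>2)"
        unfolding T_eq[OF z]
        using field[OF F z] field[OF G z] not_empty FG
        by (intro sq_diff_integral_mixture_le) (auto simp: M(2)[OF z])
      then show ?thesis
        using gamma d(1)
        by (subst ennsqrt_le_ennreal_iff) (simp_all add: power_mult_distrib ennreal_mult)
    qed
    then show ?thesis
      unfolding d using gamma d(1)
      by (auto simp: cramer_sup_dist_def space_N simp flip: ennreal_mult intro!: SUP_least)
  qed
  with T_field show ?thesis
    unfolding T_def by blast
qed

end
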